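(* Let $k \in \{1,2,3\}$ and let $\mathbb{H}P^k$ be quaternionic projective space (of real dimension $4k$). Let $A$, $B$, $C$ be three copies of the canonical quaternionic line bundle over $\mathbb{H}P^k$, regarded as a complex vector bundle of rank $2$, whose second Chern class is the generator $1 \in H^4(\mathbb{H}P^k;\mathbb{Z}) \cong \mathbb{Z}$, and let $P = A \otimes B \otimes C$. Then none of $A$, $B$, $C$ has a nowhere vanishing continuous section, $P$ has a nowhere vanishing continuous section, and there is no nowhere vanishing continuous section $\Gamma$ of $P$ such that $\Gamma(x)$ is of GHZ type for all $x \in \mathbb{H}P^k$.
   Context: A nonzero vector $\psi \in \mathbb{C}^2 \otimes \mathbb{C}^2 \otimes \mathbb{C}^2$ is of GHZ type if it lies in the SLOCC class $\widehat{\mathrm{GHZ}}$, i.e. if there exist invertible matrices $M_1, M_2, M_3 \in \mathrm{GL}(2,\mathbb{C})$ with $\psi = (M_1 \otimes M_2 \otimes M_3)(|000\rangle + |111\rangle)$. This condition is invariant under $\mathrm{GL}(2,\mathbb{C})^3$, so it makes sense for vectors in the fibers $A_x \otimes B_x \otimes C_x$. *)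

theory Defs
  imports "HOL-Analysis.Analysis"
begin

text \<open>Quaternions, by the Cayley--Dickson construction: the pair \<open>(a, b)\<close> stands for \<open>a + b j\<close>,
  where \<open>j j = -1\<close> and \<open>j z = cnj z j\<close> for complex \<open>z\<close>.\<close>

type_synonym quat = "complex \<times> complex"

definition qmult :: "quat \<Rightarrow> quat \<Rightarrow> quat"
  where "qmult p q =
    (fst p * fst q - snd p * cnj (snd q), fst p * snd q + snd p * cnj (fst q))"

definition qscale :: "quat \<Rightarrow> quat ^ 'n \<Rightarrow> quat ^ 'n"
  where "qscale q v = (\<chi> i. qmult q (v $ i))"

definition qline :: "quat ^ 'n \<Rightarrow> (quat ^ 'n) set"
  where "qline v = range (\<lambda>q. qscale q v)"


definition quotient_topology :: "'a topology \<Rightarrow> ('a \<Rightarrow> 'b) \<Rightarrow> 'b topology"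
  where "quotient_topology X f =
    topology (\<lambda>U. U \<subseteq> f ` topspace X \<and> openin X {x \<in> topspace X. f x \<in> U})"

lemma openin_quotient_topology:
  "openin (quotient_topology X f) U \<longleftrightarrow>
     U \<subseteq> f ` topspace X \<and> openin X {x \<in> topspace X. f x \<in> U}"
proof -
  have "istopology (\<lambda>U. U \<subseteq> f ` topspace X \<and> openin X {x \<in> topspace X. f x \<in> U})"
    unfolding istopology_def
  proof (intro conjI allI impI)
    fix S T
    assume "S \<subseteq> f ` topspace X \<and> openin X {x \<in> topspace X. f x \<in> S}"
      and "T \<subseteq> f ` topspace X \<and> openin X {x \<in> topspace X. f x \<in> T}"
    moreover have "{x \<in> topspace X. f x \<in> S \<inter> T} =
        {x \<in> topspace X. f x \<in> S} \<inter> {x \<in> topspace X. f x \<in> T}"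
      by blast
    ultimately show "S \<inter> T \<subseteq> f ` topspace X" "openin X {x \<in> topspace X. f x \<in> S \<inter> T}"
      by auto
  next
    fix K
    assume K: "\<forall>U\<in>K. U \<subseteq> f ` topspace X \<and> openin X {x \<in> topspace X. f x \<in> U}"
    then show "\<Union>K \<subseteq> f ` topspace X"
      by blast
    have "{x \<in> topspace X. f x \<in> \<Union>K} = (\<Union>U\<in>K. {x \<in> topspace X. f x \<in> U})"
      by blast
    with K show "openin X {x \<in> topspace X. f x \<in> \<Union>K}"
      by auto
  qed
  then show ?thesis
    by (simp add: quotient_topology_def topology_inverse')
qed

lemma topspace_quotient_topology [simp]: "topspace (quotient_topology X f) = f ` topspace X"
proof -
  have "openin (quotient_topology X f) (f ` topspace X)"
  proof -
    have "{x \<in> topspace X. f x \<in> f ` topspace X} = topspace X"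
      by blast
    then show ?thesis
      by (simp add: openin_quotient_topology)
  qed
  then show ?thesis
    by (metis openin_quotient_topology openin_subset openin_topspace subset_antisym)
qed

lemma quotient_map_quotient_topology: "quotient_map X (quotient_topology X f) f"
  by (auto simp: quotient_map_def openin_quotient_topology)


text \<open>Quaternionic projective space: the quotient of the nonzero vectors of \<open>H^n\<close> that identifies
  two vectors when they span the same (left) quaternionic line. Its points are the lines
  themselves, and its real dimension is \<open>4 (CARD('n) - 1)\<close>.\<close>

definition quat_proj_space :: "(quat ^ 'n) set topology"
  where "quat_proj_space = quotient_topology (top_of_set (- {0})) qline"


text \<open>All bundles below are subbundles of a trivial bundle \<open>X \<times> C^m\<close>: a bundle over \<open>X\<close> is given by
  its fibers, which are complex subspaces of \<open>C^m\<close>, and its total space carries the subspace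
  topology.\<close>

definition total_space :: "'x topology \<Rightarrow> ('x \<Rightarrow> (complex ^ 'm) set) \<Rightarrow> ('x \<times> (complex ^ 'm)) topology"
  where "total_space X E =
    subtopology (prod_topology X euclidean) (SIGMA x : topspace X. E x)"

definition continuous_section ::
    "'x topology \<Rightarrow> ('x \<Rightarrow> (complex ^ 'm) set) \<Rightarrow> ('x \<Rightarrow> complex ^ 'm) \<Rightarrow> bool"
  where "continuous_section X E s \<longleftrightarrow> continuous_map X (total_space X E) (\<lambda>x. (x, s x))"

definition nowhere_vanishing :: "'x topology \<Rightarrow> ('x \<Rightarrow> complex ^ 'm) \<Rightarrow> bool"
  where "nowhere_vanishing X s \<longleftrightarrow> (\<forall>x \<in> topspace X. s x \<noteq> 0)"


text \<open>The identification of \<open>H^n\<close> with \<open>C^(2n)\<close>. Left multiplication by the quaternion \<open>(z, 0)\<close>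
  becomes scalar multiplication by the complex number \<open>z\<close>, so a left quaternionic line becomes
  a complex subspace of dimension 2.\<close>

definition complex_coords :: "quat ^ 'n \<Rightarrow> complex ^ ('n \<times> 2)"
  where "complex_coords v = (\<chi> p. if snd p = 1 then fst (v $ fst p) else snd (v $ fst p))"

lemma complex_coords_qscale: "complex_coords (qscale (z, 0) v) = z *s complex_coords v"
  by (simp add: complex_coords_def qscale_def qmult_def vec_eq_iff)

text \<open>The canonical bundle: the fiber over a line is that line, as a complex vector space.\<close>

definition canonical_bundle :: "(quat ^ 'n) set \<Rightarrow> (complex ^ ('n \<times> 2)) set"
  where "canonical_bundle l = complex_coords ` l"


text \<open>The tensor product of \<open>C^a\<close>, \<open>C^b\<close>, \<open>C^c\<close> is realized as \<open>C^(a * b * c)\<close>, and the tensor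
  product of subspaces as the subspace spanned by the elementary tensors.\<close>

definition tensor_vec ::
    "complex ^ 'a \<Rightarrow> complex ^ 'b \<Rightarrow> complex ^ 'c \<Rightarrow> complex ^ ('a \<times> 'b \<times> 'c)"
  where "tensor_vec u v w = (\<chi> p. case p of (i, j, k) \<Rightarrow> u $ i * v $ j * w $ k)"

definition tensor_space ::
    "(complex ^ 'a) set \<Rightarrow> (complex ^ 'b) set \<Rightarrow> (complex ^ 'c) set
      \<Rightarrow> (complex ^ ('a \<times> 'b \<times> 'c)) set"
  where "tensor_space U V W = vec.span {tensor_vec u v w | u v w. u \<in> U \<and> v \<in> V \<and> w \<in> W}"

definition tensor_bundle ::
    "('x \<Rightarrow> (complex ^ 'a) set) \<Rightarrow> ('x \<Rightarrow> (complex ^ 'b) set) \<Rightarrow> ('x \<Rightarrow> (complex ^ 'c) set)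
      \<Rightarrow> 'x \<Rightarrow> (complex ^ ('a \<times> 'b \<times> 'c)) set"
  where "tensor_bundle A B C x = tensor_space (A x) (B x) (C x)"

definition tensor_map ::
    "complex ^ 'd ^ 'a \<Rightarrow> complex ^ 'e ^ 'b \<Rightarrow> complex ^ 'f ^ 'c
      \<Rightarrow> complex ^ ('d \<times> 'e \<times> 'f) \<Rightarrow> complex ^ ('a \<times> 'b \<times> 'c)"
  where "tensor_map L M N \<psi> =
    (\<chi> p. case p of (i, j, k) \<Rightarrow> \<Sum>i'\<in>UNIV. \<Sum>j'\<in>UNIV. \<Sum>k'\<in>UNIV.
      L $ i $ i' * M $ j $ j' * N $ k $ k' * \<psi> $ (i', j', k'))"

lemma tensor_map_tensor_vec:
  "tensor_map L M N (tensor_vec u v w) = tensor_vec (L *v u) (M *v v) (N *v w)"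
proof -
  have "(\<Sum>i\<in>UNIV. f i) * (\<Sum>j\<in>UNIV. g j) * (\<Sum>k\<in>UNIV. h k) =
      (\<Sum>i\<in>UNIV. \<Sum>j\<in>UNIV. \<Sum>k\<in>UNIV. f i * g j * h k)"
    for f :: "'d \<Rightarrow> complex" and g :: "'e \<Rightarrow> complex" and h :: "'f \<Rightarrow> complex"
    by (simp only: mult.assoc sum_distrib_left [symmetric] sum_distrib_right [symmetric])
  then show ?thesis
    by (simp add: tensor_map_def tensor_vec_def matrix_vector_mult_def vec_eq_iff ac_simps)
qed


text \<open>The basis vectors \<open>|0>\<close> and \<open>|1>\<close> of \<open>C^2\<close> are \<open>axis 1 1\<close> and \<open>axis 2 1\<close>.\<close>

definition ghz_vec :: "complex ^ (2 \<times> 2 \<times> 2)"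
  where "ghz_vec = tensor_vec (axis 1 1) (axis 1 1) (axis 1 1)
                 + tensor_vec (axis 2 1) (axis 2 1) (axis 2 1)"

definition ghz_type :: "complex ^ (2 \<times> 2 \<times> 2) \<Rightarrow> bool"
  where "ghz_type \<psi> \<longleftrightarrow>
    (\<exists>M1 M2 M3 :: complex ^ 2 ^ 2. invertible M1 \<and> invertible M2 \<and> invertible M3 \<and>
       \<psi> = tensor_map M1 M2 M3 ghz_vec)"

text \<open>For two-dimensional subspaces \<open>U\<close>, \<open>V\<close>, \<open>W\<close>, the condition is transported from \<open>C^2\<close> along
  linear isomorphisms \<open>F1\<close>, \<open>F2\<close>, \<open>F3\<close>, given by matrices. As \<open>ghz_type\<close> is invariant under
  invertible matrices, any choice of isomorphisms gives the same condition.\<close>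

definition ghz_type_in ::
    "(complex ^ 'a) set \<Rightarrow> (complex ^ 'b) set \<Rightarrow> (complex ^ 'c) set
      \<Rightarrow> complex ^ ('a \<times> 'b \<times> 'c) \<Rightarrow> bool"
  where "ghz_type_in U V W \<psi> \<longleftrightarrow>
    (\<exists>(F1 :: complex ^ 2 ^ 'a) (F2 :: complex ^ 2 ^ 'b) (F3 :: complex ^ 2 ^ 'c) \<phi>.
       bij_betw ((*v) F1) UNIV U \<and> bij_betw ((*v) F2) UNIV V \<and> bij_betw ((*v) F3) UNIV W \<and>
       ghz_type \<phi> \<and> \<psi> = tensor_map F1 F2 F3 \<phi>)"

end

theory Submission
  imports Defs
begin

text \<open>Over two hemispherical charts of a projective line \<open>HP^1\<close>, a nowhere vanishing section of the
  canonical bundle consists of two maps from the 4-ball to the nonzero quaternions that are related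
  on the boundary sphere by right multiplication by \<open>q\<close>. Contracting both balls would contract the
  identity of the 3-sphere. The argument survives if the two maps only agree up to a nonzero complex
  factor, because a map from the 3-sphere to the nonzero complex numbers has a logarithm.

  A section of GHZ type is excluded by reducing it to this situation. Contracting two tensor
  factors yields a traceless endomorphism \<open>N\<close> of \<open>A\<close> whose square is the hyperdeterminant, which is
  nonzero on the GHZ class. Over a ball the hyperdeterminant has a square root, and the
  corresponding eigenline of \<open>N\<close> has a nowhere vanishing section; on the boundary sphere the
  two choices of the root differ by a constant sign, so the two eigenlines can be matched.

  The positive part is an explicit formula in four quaternionic coordinates, which is why the
  dimension bound \<open>k \<le> 3\<close> enters.\<close>

section \<open>Quaternions and the clutching function of the canonical bundle\<close>

lemma qmult_assoc: "qmult (qmult p q) r = qmult p (qmult q r)"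
  by (simp add: qmult_def algebra_simps)

lemma qmult_one [simp]: "qmult (1, 0) q = q" "qmult q (1, 0) = q"
  by (simp_all add: qmult_def)

text \<open>Stated over the complex numbers, so that norm identities become polynomial identities in
  the components and their conjugates.\<close>

lemma norm_quat: "complex_of_real ((norm q)\<^sup>2) = fst q * cnj (fst q) + snd q * cnj (snd q)"
  for q :: quat
  by (simp add: norm_prod_def complex_norm_square[symmetric])

lemma norm_qmult: "norm (qmult p q) = norm p * norm q"
proof -
  have "complex_of_real ((norm (qmult p q))\<^sup>2) = complex_of_real ((norm p * norm q)\<^sup>2)"
    unfolding power_mult_distrib of_real_mult norm_quat by (simp add: qmult_def algebra_simps)
  then show ?thesis
    by (simp only: of_real_eq_iff) (simp add: power2_eq_iff_nonneg)
qed

lemma complex_pair_eq_0_iff: "(z, 0) = (0 :: quat) \<longleftrightarrow> z = 0"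
  by (simp add: zero_prod_def)

lemma qmult_eq_0_iff: "qmult p q = 0 \<longleftrightarrow> p = 0 \<or> q = 0"
  by (metis norm_qmult mult_eq_0_iff norm_eq_zero)

definition qcnj :: "quat \<Rightarrow> quat"
  where "qcnj q = (cnj (fst q), - snd q)"

lemma norm_qcnj [simp]: "norm (qcnj q) = norm q"
  by (simp add: qcnj_def norm_prod_def)

lemma qcnj_qmult: "qcnj (qmult p q) = qmult (qcnj q) (qcnj p)"
  by (simp add: qcnj_def qmult_def algebra_simps)

lemma qmult_qcnj:
  "qmult q (qcnj q) = (complex_of_real ((norm q)\<^sup>2), 0)"
  "qmult (qcnj q) q = (complex_of_real ((norm q)\<^sup>2), 0)"
  unfolding norm_quat by (simp_all add: qcnj_def qmult_def algebra_simps)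

definition qinv :: "quat \<Rightarrow> quat"
  where "qinv q = qcnj q /\<^sub>R (norm q)\<^sup>2"

lemma qmult_scaleR: "qmult (r *\<^sub>R p) q = r *\<^sub>R qmult p q" "qmult p (r *\<^sub>R q) = r *\<^sub>R qmult p q"
  by (simp_all add: qmult_def scaleR_conv_of_real algebra_simps)

lemma qmult_qinv: "q \<noteq> 0 \<Longrightarrow> qmult (qinv q) q = (1, 0)"
  by (simp add: qinv_def qmult_scaleR qmult_qcnj scaleR_conv_of_real)

lemma qinv_eq_0_iff: "qinv q = 0 \<longleftrightarrow> q = 0"
  by (auto simp: qinv_def qcnj_def prod_eq_iff)

lemma continuous_on_qmult [continuous_intros]:
  "continuous_on S f \<Longrightarrow> continuous_on S g \<Longrightarrow> continuous_on S (\<lambda>x. qmult (f x) (g x))"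
  unfolding qmult_def by (intro continuous_intros)

lemma continuous_on_qcnj [continuous_intros]:
  "continuous_on S f \<Longrightarrow> continuous_on S (\<lambda>x. qcnj (f x))"
  unfolding qcnj_def by (intro continuous_intros)

lemma continuous_on_qinv [continuous_intros]:
  "continuous_on S f \<Longrightarrow> (\<And>x. x \<in> S \<Longrightarrow> f x \<noteq> 0) \<Longrightarrow> continuous_on S (\<lambda>x. qinv (f x))"
  unfolding qinv_def by (intro continuous_intros) auto

text \<open>Composing with \<open>sgn\<close> pushes the homotopy into the sphere itself, which
  would then be contractible.\<close>

lemma no_nullhomotopy_sphere:
  fixes c :: "'a::euclidean_space"
  assumes "homotopic_with_canon (\<lambda>_. True) (sphere 0 1) (- {0}) (\<lambda>_. c) (\<lambda>x::'a. x)"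
  shows False
proof -
  have "homotopic_with_canon (\<lambda>_. True) (sphere 0 1) (sphere 0 1)
          (sgn \<circ> (\<lambda>_. c)) (sgn \<circ> (\<lambda>x::'a. x))"
  proof (rule homotopic_with_compose_continuous_left [OF assms])
    show "continuous_on (- {0::'a}) sgn"
      unfolding sgn_div_norm by (intro continuous_intros) auto
    show "sgn \<in> - {0::'a} \<rightarrow> sphere 0 1"
      by (auto simp: norm_sgn)
  qed
  then have "homotopic_with_canon (\<lambda>_. True) (sphere 0 1) (sphere 0 1) id (\<lambda>_::'a. sgn c)"
    by (subst homotopic_with_sym, elim homotopic_with_eq) (auto simp: sgn_div_norm)
  then have "contractible (sphere (0::'a) 1)"
    unfolding contractible_def by blast
  then show False
    by (simp add: contractible_sphere)
qed

text \<open>The maps \<open>s\<close> and \<open>t\<close> are sections over the two hemispheres of \<open>HP^1\<close>, glued by the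
  clutching function, right multiplication by \<open>q\<close>. Shrinking the hemispheres contracts the
  identity of the 3-sphere to a constant.\<close>

lemma hemispheres_not_compatible:
  fixes s t :: "quat \<Rightarrow> quat" and c :: "quat \<Rightarrow> complex"
  assumes s: "continuous_on (cball 0 1) s" "\<And>q. q \<in> cball 0 1 \<Longrightarrow> s q \<noteq> 0"
    and t: "continuous_on (cball 0 1) t" "\<And>q. q \<in> cball 0 1 \<Longrightarrow> t q \<noteq> 0"
    and l: "continuous_on (sphere 0 1) c" "\<And>q. q \<in> sphere 0 1 \<Longrightarrow> c q \<noteq> 0"
    and eq: "\<And>q. q \<in> sphere 0 1 \<Longrightarrow> qmult (s q) q = qmult (c q, 0) (t (qcnj q))"
  shows False
proof -
  \<comment> \<open>The unit quaternions form a 3-sphere, which is simply connected; the logarithm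
    lets \<open>c\<close> be deformed to 1 without meeting 0.\<close>
  obtain g where g: "continuous_on (sphere 0 1) g" "\<And>q. q \<in> sphere 0 1 \<Longrightarrow> c q = exp (g q)"
  proof (rule continuous_logarithm_on_simply_connected [OF l(1)])
    show "simply_connected (sphere (0::quat) 1)"
      by (simp add: simply_connected_sphere)
    show "locally path_connected (sphere (0::quat) 1)"
      by (simp add: locally_path_connected_sphere)
  qed (use l in auto)
  \<comment> \<open>The gluing equation solved for \<open>q\<close>, with \<open>s\<close> and
    \<open>t\<close> evaluated at radius \<open>fst z\<close> and \<open>c\<close> replaced by
    \<open>exp (fst z *\<^sub>R g)\<close>. Time 1 returns \<open>q\<close>; at time 0 nothing
    depends on \<open>q\<close>.\<close>
  define h where "h = (\<lambda>z :: real \<times> quat.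
    qmult (qinv (s (fst z *\<^sub>R snd z)))
      (qmult (exp (fst z *\<^sub>R g (snd z)), 0) (t (fst z *\<^sub>R qcnj (snd z)))))"
  let ?c = "qmult (qinv (s 0)) (t 0)"
  have in_ball: "fst z *\<^sub>R snd z \<in> cball 0 1" "fst z *\<^sub>R qcnj (snd z) \<in> cball 0 1"
    if "z \<in> {0..1} \<times> sphere 0 1" for z :: "real \<times> quat"
    using that by auto
  have h1: "h (1, q) = q" if "q \<in> sphere 0 1" for q
  proof -
    have "h (1, q) = qmult (qinv (s q)) (qmult (s q) q)"
      using that by (simp add: h_def eq g)
    then show ?thesis
      using s(2)[of q] that by (simp add: qmult_qinv flip: qmult_assoc)
  qed
  have "homotopic_with_canon (\<lambda>_. True) (sphere 0 1) (- {0}) (\<lambda>_. ?c) (\<lambda>q. h (1, q))"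
    unfolding homotopic_with_def
  proof (intro exI conjI allI ballI TrueI)
    have "continuous_on ({0..1} \<times> sphere 0 1) (\<lambda>z. s (fst z *\<^sub>R snd z))"
      "continuous_on ({0..1} \<times> sphere 0 1) (\<lambda>z. t (fst z *\<^sub>R qcnj (snd z)))"
      "continuous_on ({0..1} \<times> sphere 0 1) (\<lambda>z. g (snd z))"
      using in_ball
      by (intro continuous_on_compose2 [OF s(1)] continuous_on_compose2 [OF t(1)]
          continuous_on_compose2 [OF g(1)] continuous_intros image_subsetI; force)+
    then have "continuous_on ({0..1} \<times> sphere 0 1) h"
      unfolding h_def
      by (intro continuous_intros) (use in_ball s(2) in blast)+
    moreover have "h z \<noteq> 0" if "z \<in> {0..1} \<times> sphere 0 1" for z
      using s(2) t(2) in_ball[OF that] by (simp add: h_def qmult_eq_0_iff qinv_eq_0_iff complex_pair_eq_0_iff)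
    ultimately show "continuous_map (prod_topology (top_of_set {0..1}) (top_of_set (sphere 0 1)))
        (top_of_set (- {0})) h"
      by (auto simp flip: subtopology_Times)
    show "h (0, q) = ?c" for q
      by (simp add: h_def)
  next
    show "h (1, q) = h (1, q)" for q
      by simp
  qed
  then have "homotopic_with_canon (\<lambda>_. True) (sphere 0 1) (- {0}) (\<lambda>_. ?c) (\<lambda>q. q)"
    by (rule homotopic_with_eq) (auto simp: h1)
  then show False
    by (rule no_nullhomotopy_sphere)
qed

section \<open>Eigenline bundles over a ball\<close>

text \<open>A nonzero vector in the image of the projector at the centre is carried outwards by
  applying the projectors at finitely many points of each radius: nearby projectors move unit
  vectors by less than 1, so the vector stays nonzero.\<close>

lemma projectors_on_ball_have_section:
  fixes P :: "'a::euclidean_space \<Rightarrow> 'b::euclidean_space \<Rightarrow> 'b"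
  assumes cont: "continuous_on (cball 0 1 \<times> UNIV) (\<lambda>z. P (fst z) (snd z))"
    and lin: "\<And>x. x \<in> cball 0 1 \<Longrightarrow> linear (P x)"
    and proj: "\<And>x w. x \<in> cball 0 1 \<Longrightarrow> P x (P x w) = P x w"
    and w0: "P 0 w0 \<noteq> 0"
  obtains s where "continuous_on (cball 0 1) s" "\<And>x. x \<in> cball 0 1 \<Longrightarrow> s x \<noteq> 0"
    "\<And>x. x \<in> cball 0 1 \<Longrightarrow> P x (s x) = s x"
proof -
  have "uniformly_continuous_on (cball 0 1 \<times> sphere 0 1) (\<lambda>z. P (fst z) (snd z))"
    by (intro compact_uniformly_continuous continuous_on_subset [OF cont] compact_Times) auto
  then obtain d where d: "d > 0" "\<And>z z'. z \<in> cball 0 1 \<times> sphere 0 1 \<Longrightarrow>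
      z' \<in> cball 0 1 \<times> sphere 0 1 \<Longrightarrow> dist z' z < d \<Longrightarrow>
      dist (P (fst z') (snd z')) (P (fst z) (snd z)) < 1"
    unfolding uniformly_continuous_on_def by (metis zero_less_one)
  have step: "P y w \<noteq> 0"
    if xy: "x \<in> cball 0 1" "y \<in> cball 0 1" "dist y x < d" and w: "P x w = w" "w \<noteq> 0" for x y w
  proof
    assume "P y w = 0"
    then have 0: "P y (sgn w) = 0"
      using lin[OF xy(2)] by (simp add: sgn_div_norm linear_scale)
    have 1: "P x (sgn w) = sgn w"
      using lin[OF xy(1)] w by (simp add: sgn_div_norm linear_scale)
    have "dist (P y (sgn w)) (P x (sgn w)) < 1"
      using d(2)[of "(x, sgn w)" "(y, sgn w)"] xy w by (simp add: norm_sgn dist_Pair_Pair)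
    then show False
      using 0 1 w by (simp add: norm_sgn)
  qed
  obtain N where N: "1 / real (Suc N) < d"
    using d(1) by (metis nat_approx_posE)
  \<comment> \<open>After stage \<open>n\<close> the vector \<open>s x\<close> lies in the image of
    the projector at \<open>x\<close> shrunk by \<open>n / Suc N\<close>. Stage 0 sits at the
    centre, stage \<open>Suc N\<close> at \<open>x\<close> itself.\<close>
  have "\<exists>s. continuous_on (cball 0 1) s \<and> (\<forall>x\<in>cball 0 1. s x \<noteq> 0 \<and>
      P ((real n / Suc N) *\<^sub>R x) (s x) = s x)" if "n \<le> Suc N" for n
    using that
  proof (induction n)
    case 0
    show ?case
      using w0 proj[of 0] by (intro exI[of _ "\<lambda>_. P 0 w0"]) auto
  next
    case (Suc n)
    then obtain s where s: "continuous_on (cball 0 1) s" "\<And>x. x \<in> cball 0 1 \<Longrightarrow> s x \<noteq> 0"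
      "\<And>x. x \<in> cball 0 1 \<Longrightarrow> P ((real n / Suc N) *\<^sub>R x) (s x) = s x"
      by auto
    let ?p = "\<lambda>x. (real (Suc n) / Suc N) *\<^sub>R x"
    have in_ball: "(real m / Suc N) *\<^sub>R x \<in> cball 0 1" if "m \<le> Suc N" "x \<in> cball 0 1" for m and x :: 'a
    proof -
      have "real m / Suc N \<le> 1"
        using that by simp
      then have "real m / Suc N * norm x \<le> 1 * 1"
        using that by (intro mult_mono) auto
      then show ?thesis
        by simp
    qed
    have "continuous_on (cball 0 1) (\<lambda>x. (?p x, s x))"
      by (intro continuous_intros s)
    moreover have "(\<lambda>x. (?p x, s x)) ` cball 0 1 \<subseteq> cball 0 1 \<times> UNIV"
      by (intro image_subsetI SigmaI in_ball Suc.prems) auto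
    ultimately have "continuous_on (cball 0 1) (\<lambda>x. P (?p x) (s x))"
      using continuous_on_compose2 [OF cont, of "cball 0 1" "\<lambda>x. (?p x, s x)"]
      by (simp only: fst_conv snd_conv)
    moreover have "P (?p x) (s x) \<noteq> 0" if x: "x \<in> cball 0 1" for x
    proof (rule step)
      have "dist (?p x) ((real n / Suc N) *\<^sub>R x) = norm (((real (Suc n) - real n) / Suc N) *\<^sub>R x)"
        by (simp only: dist_norm diff_divide_distrib scaleR_diff_left)
      also have "\<dots> \<le> 1 / Suc N"
        using x by (simp add: divide_right_mono)
      finally show "dist (?p x) ((real n / Suc N) *\<^sub>R x) < d"
        using N by simp
      show "?p x \<in> cball 0 1"
        by (rule in_ball [OF Suc.prems x])
      show "(real n / Suc N) *\<^sub>R x \<in> cball 0 1"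
        using Suc.prems x by (intro in_ball) auto
    qed (rule s x)+
    moreover have "P (?p x) (P (?p x) (s x)) = P (?p x) (s x)" if "x \<in> cball 0 1" for x
      using in_ball[of "Suc n" x] Suc.prems that by (intro proj) auto
    ultimately show ?case
      by blast
  qed
  from this[of "Suc N"] show ?thesis
    using that by auto
qed

definition traceless_map :: "complex \<times> complex \<times> complex \<Rightarrow> quat \<Rightarrow> quat"
  where "traceless_map = (\<lambda>(a, b, c) w. (a * fst w + b * snd w, c * fst w - a * snd w))"

text \<open>A traceless \<open>N\<close> with \<open>N^2 = g^2\<close> has the eigenprojector
  \<open>P = (1 + N / g) / 2\<close>, which depends continuously on the point, so the preceding
  lemma applies.\<close>

lemma traceless_eigenvectors_on_ball:
  fixes n :: "'a::euclidean_space \<Rightarrow> complex \<times> complex \<times> complex" and g :: "'a \<Rightarrow> complex"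
  assumes cont: "continuous_on (cball 0 1) n" "continuous_on (cball 0 1) g"
    and sq: "\<And>x. x \<in> cball 0 1 \<Longrightarrow> (fst (n x))\<^sup>2 + fst (snd (n x)) * snd (snd (n x)) = (g x)\<^sup>2"
    and g: "\<And>x. x \<in> cball 0 1 \<Longrightarrow> g x \<noteq> 0"
  obtains s where "continuous_on (cball 0 1) s" "\<And>x. x \<in> cball 0 1 \<Longrightarrow> s x \<noteq> 0"
    "\<And>x. x \<in> cball 0 1 \<Longrightarrow> traceless_map (n x) (s x) = qmult (g x, 0) (s x)"
proof -
  define P where "P x w = (1/2) *\<^sub>R (w + qmult (1 / g x, 0) (traceless_map (n x) w))" for x w
  have sq': "traceless_map (n x) (traceless_map (n x) w) = qmult ((g x)\<^sup>2, 0) w"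
    if "x \<in> cball 0 1" for x w
    unfolding sq[OF that, symmetric]
    by (simp add: traceless_map_def qmult_def split_def power2_eq_square algebra_simps)
  have lin: "traceless_map (n x) (r *\<^sub>R v + w) = r *\<^sub>R traceless_map (n x) v + traceless_map (n x) w"
    "traceless_map (n x) (qmult (z, 0) w) = qmult (z, 0) (traceless_map (n x) w)" for x r v w z
    by (simp_all add: traceless_map_def qmult_def split_def scaleR_conv_of_real algebra_simps)
  have ev: "traceless_map (n x) (P x w) = qmult (g x, 0) (P x w)" if "x \<in> cball 0 1" for x w
  proof -
    have "traceless_map (n x) (P x w) = (1/2) *\<^sub>R (traceless_map (n x) w + qmult (g x, 0) w)"
      using lin(1)[of x "1/2" "w + qmult (1 / g x, 0) (traceless_map (n x) w)" 0]
        lin(1)[of x 1 w "qmult (1 / g x, 0) (traceless_map (n x) w)"] lin(1)[of x 1 0 0]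
      using that g[OF that]
      by (simp add: P_def lin(2) sq' qmult_assoc[symmetric] power2_eq_square)
        (simp add: qmult_def power2_eq_square)
    also have "\<dots> = qmult (g x, 0) (P x w)"
      using g[OF that] by (simp add: P_def qmult_def prod_eq_iff scaleR_conv_of_real field_simps)
    finally show ?thesis .
  qed
  have id: "P x w = w" if "x \<in> cball 0 1" "traceless_map (n x) w = qmult (g x, 0) w" for x w
    using g[OF that(1)] by (simp add: P_def that(2)) (simp add: qmult_def prod_eq_iff scaleR_conv_of_real)
  \<comment> \<open>\<open>P 0\<close> has trace 1: if it killed both basis vectors, its diagonal
    entries \<open>(1 + a / g) / 2\<close> and \<open>(1 - a / g) / 2\<close> would both
    vanish.\<close>
  obtain w0 where w0: "P 0 w0 \<noteq> 0"
  proof (rule ccontr)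
    assume "\<not> thesis"
    then have "P 0 (1, 0) = 0" "P 0 (0, 1) = 0"
      using that by blast+
    then have "1 + fst (n 0) / g 0 = 0" "1 - fst (n 0) / g 0 = 0"
      using g[of 0]
      by (auto simp: P_def qmult_def traceless_map_def split_def prod_eq_iff)
    then show False
      by (simp add: eq_neg_iff_add_eq_0)
  qed
  show ?thesis
  proof (rule projectors_on_ball_have_section [of P w0])
    have n1: "continuous_on (cball 0 1 \<times> UNIV) (\<lambda>z::'a \<times> quat. n (fst z))"
      "continuous_on (cball 0 1 \<times> UNIV) (\<lambda>z::'a \<times> quat. g (fst z))"
      by (intro continuous_on_compose2 [OF cont(1)] continuous_on_compose2 [OF cont(2)] continuous_intros; force)+
    show "continuous_on (cball 0 1 \<times> UNIV) (\<lambda>z. P (fst z) (snd z))"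
      unfolding P_def traceless_map_def split_def
      by (intro continuous_intros n1) (use g in auto)
    show "linear (P x)" for x
    proof (rule linearI)
      show "P x (v + w) = P x v + P x w" "P x (r *\<^sub>R w) = r *\<^sub>R P x w" for v w r
        by (simp_all add: P_def traceless_map_def qmult_def split_def scaleR_conv_of_real algebra_simps
            add_divide_distrib diff_divide_distrib)
    qed
    fix s
    assume s: "continuous_on (cball 0 1) s" "\<And>x. x \<in> cball 0 1 \<Longrightarrow> s x \<noteq> 0"
      "\<And>x. x \<in> cball 0 1 \<Longrightarrow> P x (s x) = s x"
    show thesis
      by (rule that[of s]) (use s ev in \<open>metis+\<close>)
  qed (use w0 ev id in auto)
qed

text \<open>Two independent eigenvectors for the same \<open>g\<close> would make the map
  \<open>g\<close> times the identity, whose trace \<open>2 g\<close> is not zero.\<close>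

lemma traceless_eigenvector_unique:
  assumes "traceless_map n v = qmult (g, 0) v" "traceless_map n w = qmult (g, 0) w" "g \<noteq> 0"
  shows "fst v * snd w = fst w * snd v"
proof -
  obtain a b c where n: "n = (a, b, c)"
    by (cases n)
  let ?d = "fst v * snd w - fst w * snd v"
  have *: "a * fst v + b * snd v = g * fst v" "c * fst v - a * snd v = g * snd v"
    "a * fst w + b * snd w = g * fst w" "c * fst w - a * snd w = g * snd w"
    using assms(1,2) by (simp_all add: n traceless_map_def qmult_def prod_eq_iff)
  have "(a - g) * ?d = 0" "(a + g) * ?d = 0"
    using * by algebra+
  then show ?thesis
    using assms(3) by auto
qed

section \<open>Tensor maps and the Cayley covariant of a three-qubit state\<close>

lemma tensor_map_component:
  "tensor_map L M N \<psi> $ (i, j, k) =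
    (\<Sum>(i', j', k')\<in>UNIV. L $ i $ i' * M $ j $ j' * N $ k $ k' * \<psi> $ (i', j', k'))"
  by (simp add: tensor_map_def sum.cartesian_product split_def flip: UNIV_Times_UNIV)

lemma sum_mult_sum_mult_sum:
  fixes f :: "'a::finite \<Rightarrow> 'd::comm_semiring_1" and g :: "'b::finite \<Rightarrow> 'd" and h :: "'c::finite \<Rightarrow> 'd"
  shows "(\<Sum>i\<in>UNIV. f i) * (\<Sum>j\<in>UNIV. g j) * (\<Sum>k\<in>UNIV. h k) =
    (\<Sum>(i, j, k)\<in>UNIV. f i * g j * h k)"
proof -
  have "(\<Sum>i\<in>UNIV. f i) * (\<Sum>j\<in>UNIV. g j) * (\<Sum>k\<in>UNIV. h k) =
      (\<Sum>i\<in>UNIV. \<Sum>j\<in>UNIV. \<Sum>k\<in>UNIV. f i * g j * h k)"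
    by (simp only: mult.assoc sum_distrib_left [symmetric] sum_distrib_right [symmetric])
  then show ?thesis
    by (simp add: sum.cartesian_product split_def flip: UNIV_Times_UNIV)
qed

section \<open>Composition and injectivity of tensor maps\<close>

lemma tensor_map_tensor_map:
  "tensor_map L M N (tensor_map L' M' N' \<psi>) = tensor_map (L ** L') (M ** M') (N ** N') \<psi>"
proof -
  have "tensor_map L M N (tensor_map L' M' N' \<psi>) $ (i, j, k) =
      tensor_map (L ** L') (M ** M') (N ** N') \<psi> $ (i, j, k)" for i j k
  proof -
    have "tensor_map (L ** L') (M ** M') (N ** N') \<psi> $ (i, j, k) =
      (\<Sum>(i', j', k')\<in>UNIV. \<Sum>(a, b, c)\<in>UNIV.
        (L $ i $ a * L' $ a $ i') * (M $ j $ b * M' $ b $ j') * (N $ k $ c * N' $ c $ k') * \<psi> $ (i', j', k'))"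
      unfolding tensor_map_component matrix_matrix_mult_def
      by (simp only: sum_mult_sum_mult_sum vec_lambda_beta) (simp add: sum_distrib_right split_def)
    also have "\<dots> = tensor_map L M N (tensor_map L' M' N' \<psi>) $ (i, j, k)"
      unfolding tensor_map_component split_def
      by (subst sum.swap) (simp add: tensor_map_component sum_distrib_left split_def ac_simps)
    finally show ?thesis
      by simp
  qed
  then show ?thesis
    by (auto simp: vec_eq_iff)
qed

lemma tensor_map_mat_1 [simp]: "tensor_map (mat 1) (mat 1) (mat 1) \<psi> = \<psi>"
proof -
  have "tensor_map (mat 1) (mat 1) (mat 1) \<psi> $ (i, j, k) = \<psi> $ (i, j, k)" for i j k
  proof -
    have "tensor_map (mat 1) (mat 1) (mat 1) \<psi> $ (i, j, k) =
        (\<Sum>p\<in>UNIV. if p = (i, j, k) then \<psi> $ p else 0)"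
      unfolding tensor_map_component by (intro sum.cong) (auto simp: mat_def split: if_splits)
    then show ?thesis
      by simp
  qed
  then show ?thesis
    by (auto simp: vec_eq_iff)
qed

lemma tensor_map_eq_0D:
  assumes "inj ((*v) L)" "inj ((*v) M)" "inj ((*v) N)" "tensor_map L M N \<psi> = 0"
  shows "\<psi> = 0"
proof -
  obtain L' M' N' where "L' ** L = mat 1" "M' ** M = mat 1" "N' ** N = mat 1"
    using assms(1-3) unfolding matrix_left_invertible_injective[symmetric] by blast
  then have "\<psi> = tensor_map L' M' N' (tensor_map L M N \<psi>)"
    by (simp add: tensor_map_tensor_map)
  also have "\<dots> = 0"
    by (simp only: assms(4)) (simp add: tensor_map_def vec_eq_iff)
  finally show ?thesis .
qed

text \<open>Contracting the last two factors of \<open>C^2 \<otimes> C^2 \<otimes> C^2\<close> by the determinant gives a binary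
  quadratic form on the dual of the first factor, with symmetric matrix \<open>S\<close> = \<open>slice_det\<close>. The triple \<open>(a, b, c)\<close>
  stands for the traceless matrix \<open>S J = [[a, b], [c, -a]]\<close>, where \<open>J = [[0, 1], [-1, 0]]\<close>; it is
  an equivariant endomorphism of the first factor, and \<open>a\<^sup>2 + b c\<close> is Cayley's
  hyperdeterminant.\<close>

definition slice_det :: "complex ^ (2 \<times> 2 \<times> 2) \<Rightarrow> 2 \<Rightarrow> 2 \<Rightarrow> complex"
  where "slice_det \<phi> i j = \<phi> $ (i, 1, 1) * \<phi> $ (j, 2, 2) + \<phi> $ (j, 1, 1) * \<phi> $ (i, 2, 2)
    - \<phi> $ (i, 1, 2) * \<phi> $ (j, 2, 1) - \<phi> $ (j, 1, 2) * \<phi> $ (i, 2, 1)"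

definition cayley_triple :: "complex ^ (2 \<times> 2 \<times> 2) \<Rightarrow> complex \<times> complex \<times> complex"
  where "cayley_triple \<phi> = (- slice_det \<phi> 1 2, slice_det \<phi> 1 1, - slice_det \<phi> 2 2)"

definition hyperdet :: "complex ^ (2 \<times> 2 \<times> 2) \<Rightarrow> complex"
  where "hyperdet \<phi> = (slice_det \<phi> 1 2)\<^sup>2 - slice_det \<phi> 1 1 * slice_det \<phi> 2 2"

text \<open>The determinant contractions of the last two factors scale by \<open>det M\<close> and
  \<open>det N\<close>; the symmetric matrix left over transforms by the congruence
  \<open>L S L^T\<close>.\<close>

lemma slice_det_tensor_map:
  fixes L M N :: "complex ^ 2 ^ 2"
  shows "slice_det (tensor_map L M N \<phi>) i j =
    det M * det N * (L $ i $ 1 * L $ j $ 1 * slice_det \<phi> 1 1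
      + (L $ i $ 1 * L $ j $ 2 + L $ i $ 2 * L $ j $ 1) * slice_det \<phi> 1 2
      + L $ i $ 2 * L $ j $ 2 * slice_det \<phi> 2 2)"
proof -
  \<comment> \<open>The tensor after acting on the last two factors only.\<close>
  define a where "a i' j k = (\<Sum>j'\<in>UNIV. \<Sum>k'\<in>UNIV. M $ j $ j' * N $ k $ k' * \<phi> $ (i', j', k'))" for i' j k
  have comp: "tensor_map L M N \<phi> $ (i, j, k) = L $ i $ 1 * a 1 j k + L $ i $ 2 * a 2 j k" for i j k
    by (simp add: tensor_map_def a_def sum_2 algebra_simps)
  have pol: "a i 1 1 * a j 2 2 + a j 1 1 * a i 2 2 - a i 1 2 * a j 2 1 - a j 1 2 * a i 2 1
      = det M * det N * slice_det \<phi> i j" for i j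
    by (simp add: a_def sum_2 det_2 slice_det_def algebra_simps)
  have "slice_det (tensor_map L M N \<phi>) i j =
      L $ i $ 1 * L $ j $ 1 * (det M * det N * slice_det \<phi> 1 1)
      + (L $ i $ 1 * L $ j $ 2 + L $ i $ 2 * L $ j $ 1) * (det M * det N * slice_det \<phi> 1 2)
      + L $ i $ 2 * L $ j $ 2 * (det M * det N * slice_det \<phi> 2 2)"
    unfolding slice_det_def[of "tensor_map L M N \<phi>"] comp pol[symmetric] by (simp add: algebra_simps)
  then show ?thesis
    by (simp only: distrib_left mult_ac)
qed

text \<open>\<open>hyperdet\<close> is minus the determinant of the 2 by 2 matrix \<open>S\<close>,
  so the congruence contributes \<open>(det L)^2\<close> and the scalar \<open>det M * det N\<close>
  enters squared.\<close>

lemma hyperdet_tensor_map: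
  fixes L M N :: "complex ^ 2 ^ 2"
  shows "hyperdet (tensor_map L M N \<phi>) = (det L * det M * det N)\<^sup>2 * hyperdet \<phi>"
proof -
  have "(l * m' * a + (l * n' + n * m') * b + n * n' * c)\<^sup>2
      - (l * l * a + (l * n + n * l) * b + n * n * c) * (m' * m' * a + (m' * n' + n' * m') * b + n' * n' * c)
      = (l * n' - n * m')\<^sup>2 * (b\<^sup>2 - a * c)" for l m' n n' a b c :: complex
    by (simp add: power2_eq_square algebra_simps)
  from this[where l = "L $ 1 $ 1" and m' = "L $ 2 $ 1" and n = "L $ 1 $ 2" and n' = "L $ 2 $ 2"] show ?thesis
    unfolding hyperdet_def slice_det_tensor_map power_mult_distrib det_2[of L]
    by (simp only: mult.assoc mult.left_commute power2_eq_square[of "det _"] flip: right_diff_distrib)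
qed

text \<open>The GHZ vector has hyperdeterminant 1, and along its orbit this changes only by squares
  of nonzero determinants.\<close>

lemma ghz_type_hyperdet: "ghz_type \<phi> \<Longrightarrow> hyperdet \<phi> \<noteq> 0"
proof -
  have "hyperdet ghz_vec = 1"
    by (simp add: hyperdet_def slice_det_def ghz_vec_def tensor_vec_def axis_def)
  then show "hyperdet \<phi> \<noteq> 0" if "ghz_type \<phi>"
    using that by (auto simp: ghz_type_def hyperdet_tensor_map invertible_det_nz)
qed

text \<open>Right multiplication by \<open>q\<close> on the quaternions, in the complex basis \<open>1, j\<close>.\<close>

definition rmat :: "quat \<Rightarrow> complex ^ 2 ^ 2"
  where "rmat q = vector [vector [fst q, - cnj (snd q)], vector [snd q, cnj (fst q)]]"

definition qvec :: "quat \<Rightarrow> complex ^ 2"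
  where "qvec q = (\<chi> i. if i = 1 then fst q else snd q)"

lemma qvec_nth [simp]: "qvec q $ 1 = fst q" "qvec q $ 2 = snd q"
  by (simp_all add: qvec_def)

lemma rmat_nth [simp]: "rmat q $ 1 $ 1 = fst q" "rmat q $ 1 $ 2 = - cnj (snd q)"
    "rmat q $ 2 $ 1 = snd q" "rmat q $ 2 $ 2 = cnj (fst q)"
  by (simp_all add: rmat_def)

lemma rmat_qvec: "rmat q *v qvec p = qvec (qmult p q)"
  by (simp add: vec_eq_iff forall_2 matrix_vector_mult_def sum_2 qmult_def)

lemma det_rmat: "det (rmat q) = complex_of_real ((norm q)\<^sup>2)"
  unfolding norm_quat by (simp add: det_2)

text \<open>In scalars, with \<open>L\<close> having rows \<open>(l, l')\<close> and
  \<open>(m, m')\<close>: \<open>L S L^T J L = det L * L S J\<close>, because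
  \<open>L^T J L = det L * J\<close>.\<close>

lemma traceless_map_change_of_basis:
  fixes l m l' m' a b c x y :: complex
  defines "x' \<equiv> fst (traceless_map (- b, a, - c) (x, y))"
    and "y' \<equiv> snd (traceless_map (- b, a, - c) (x, y))"
  shows "traceless_map
      (- (l * m * a + (l * m' + l' * m) * b + l' * m' * c),
        l * l * a + (l * l' + l' * l) * b + l' * l' * c,
        - (m * m * a + (m * m' + m' * m) * b + m' * m' * c)) (l * x + l' * y, m * x + m' * y) =
    ((l * m' - l' * m) * (l * x' + l' * y'), (l * m' - l' * m) * (m * x' + m' * y'))"
  by (simp add: traceless_map_def x'_def y'_def algebra_simps)

text \<open>For unit \<open>q\<close> every determinant factor is 1, so right multiplication by
  \<open>q\<close> carries eigenvectors to eigenvectors with the same eigenvalue.\<close>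

lemma cayley_triple_rmat:
  assumes "norm q = 1"
  shows "traceless_map (cayley_triple (tensor_map (rmat q) (rmat q) (rmat q) \<phi>)) (qmult w q) =
    qmult (traceless_map (cayley_triple \<phi>) w) q"
proof -
  have d: "fst q * cnj (fst q) + cnj (snd q) * snd q = 1"
    using norm_quat[of q] assms by (simp add: mult.commute)
  show ?thesis
    using traceless_map_change_of_basis[where l = "fst q" and l' = "- cnj (snd q)" and m = "snd q"
        and m' = "cnj (fst q)" and a = "slice_det \<phi> 1 1" and b = "slice_det \<phi> 1 2"
        and c = "slice_det \<phi> 2 2" and x = "fst w" and y = "snd w"]
    unfolding cayley_triple_def slice_det_tensor_map det_rmat assms
    by (simp add: d qmult_def mult.commute[of "fst w"] mult.commute[of "snd w"]
        mult.commute[of "fst (traceless_map _ _)"] mult.commute[of "snd (traceless_map _ _)"])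
qed

lemma hyperdet_rmat:
  "norm q = 1 \<Longrightarrow> hyperdet (tensor_map (rmat q) (rmat q) (rmat q) \<phi>) = hyperdet \<phi>"
  by (simp add: hyperdet_tensor_map det_rmat)

section \<open>Exclusion of GHZ families glued over two balls\<close>

lemma continuous_on_slice_det [continuous_intros]:
  "continuous_on S f \<Longrightarrow> continuous_on S (\<lambda>x. slice_det (f x) i j)"
  unfolding slice_det_def by (intro continuous_intros)

lemma continuous_on_cayley_triple [continuous_intros]:
  "continuous_on S f \<Longrightarrow> continuous_on S (\<lambda>x. cayley_triple (f x))"
  unfolding cayley_triple_def by (intro continuous_intros)

lemma continuous_on_hyperdet [continuous_intros]:
  "continuous_on S f \<Longrightarrow> continuous_on S (\<lambda>x. hyperdet (f x))"
  unfolding hyperdet_def by (intro continuous_intros)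

text \<open>\<open>\<phi>\<close> and \<open>\<eta>\<close> are one section in two charts.
  Eigenvectors chosen over each ball agree on the sphere up to a factor \<open>c\<close>, against
  \<open>hemispheres_not_compatible\<close>.\<close>

lemma no_ghz_on_hemispheres:
  fixes \<phi> \<eta> :: "quat \<Rightarrow> complex ^ (2 \<times> 2 \<times> 2)"
  assumes cont: "continuous_on (cball 0 1) \<phi>" "continuous_on (cball 0 1) \<eta>"
    and ghz: "\<And>q. q \<in> cball 0 1 \<Longrightarrow> ghz_type (\<phi> q)" "\<And>q. q \<in> cball 0 1 \<Longrightarrow> ghz_type (\<eta> q)"
    and eq: "\<And>q. norm q = 1 \<Longrightarrow> \<eta> (qcnj q) = tensor_map (rmat q) (rmat q) (rmat q) (\<phi> q)"
  shows False
proof -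
  have sqrt: "\<exists>g. continuous_on (cball 0 1) g \<and> (\<forall>x\<in>cball 0 1. hyperdet (\<psi> x) = (g x)\<^sup>2 \<and> g x \<noteq> 0)"
    if "continuous_on (cball 0 1) \<psi>" "\<And>q. q \<in> cball 0 1 \<Longrightarrow> ghz_type (\<psi> q)" for \<psi> :: "quat \<Rightarrow> _"
  proof -
    have nz: "\<And>q. q \<in> cball 0 1 \<Longrightarrow> hyperdet (\<psi> q) \<noteq> 0"
      using that(2) ghz_type_hyperdet by blast
    have "continuous_on (cball 0 1) (\<lambda>x. hyperdet (\<psi> x))"
      by (intro continuous_intros that(1))
    then obtain g where "continuous_on (cball 0 1) g"
        "\<And>x. x \<in> cball 0 1 \<Longrightarrow> hyperdet (\<psi> x) = (g x)\<^sup>2"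
      by (rule continuous_sqrt_on_contractible) (auto simp: nz convex_imp_contractible)
    then show ?thesis
      using nz by (metis zero_power2)
  qed
  obtain g where g: "continuous_on (cball 0 1) g"
    "\<And>x. x \<in> cball 0 1 \<Longrightarrow> hyperdet (\<phi> x) = (g x)\<^sup>2" "\<And>x. x \<in> cball 0 1 \<Longrightarrow> g x \<noteq> 0"
    using sqrt[OF cont(1) ghz(1)] by blast
  obtain h where h: "continuous_on (cball 0 1) h"
    "\<And>x. x \<in> cball 0 1 \<Longrightarrow> hyperdet (\<eta> x) = (h x)\<^sup>2" "\<And>x. x \<in> cball 0 1 \<Longrightarrow> h x \<noteq> 0"
    using sqrt[OF cont(2) ghz(2)] by blast
  \<comment> \<open>On the sphere both roots square to the same hyperdeterminant, so their ratio is
    1 or -1, and connectedness makes it constant.\<close>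
  let ?r = "\<lambda>q. h (qcnj q) / g q"
  have r: "?r q = 1 \<or> ?r q = - 1" if "q \<in> sphere 0 1" for q
  proof -
    have "(h (qcnj q))\<^sup>2 = (g q)\<^sup>2"
      using that by (simp add: h(2)[symmetric] g(2)[symmetric] eq hyperdet_rmat)
    then show ?thesis
      using that g(3)[of q] by (auto simp: power2_eq_iff)
  qed
  have conth: "continuous_on (sphere 0 1) (\<lambda>q. h (qcnj q))"
    by (rule continuous_on_compose2 [OF h(1)]) (auto intro!: continuous_intros)
  have contg: "continuous_on (sphere 0 1) g"
    by (rule continuous_on_subset [OF g(1)]) auto
  have "?r constant_on sphere 0 1"
  proof (rule continuous_finite_range_constant)
    show "connected (sphere (0::quat) 1)"
      by (simp add: connected_sphere)
    show "continuous_on (sphere 0 1) ?r"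
      using g(3) by (intro continuous_intros conth contg) auto
    show "finite (?r ` sphere 0 1)"
    proof (rule finite_subset)
      show "?r ` sphere 0 1 \<subseteq> {1, -1}"
        using r by blast
    qed simp
  qed
  then obtain \<sigma> where \<sigma>: "\<And>q. q \<in> sphere 0 1 \<Longrightarrow> ?r q = \<sigma>"
    unfolding constant_on_def by blast
  have \<sigma>1: "\<sigma> = 1 \<or> \<sigma> = - 1"
    using r[of "(1, 0)"] \<sigma>[of "(1, 0)"] by (simp add: norm_prod_def)
  have tri: "(fst (cayley_triple \<psi>))\<^sup>2 + fst (snd (cayley_triple \<psi>)) * snd (snd (cayley_triple \<psi>)) = hyperdet \<psi>" for \<psi>
    by (simp add: cayley_triple_def hyperdet_def)
  obtain s where s: "continuous_on (cball 0 1) s" "\<And>x. x \<in> cball 0 1 \<Longrightarrow> s x \<noteq> 0"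
    "\<And>x. x \<in> cball 0 1 \<Longrightarrow> traceless_map (cayley_triple (\<phi> x)) (s x) = qmult (g x, 0) (s x)"
  proof (rule traceless_eigenvectors_on_ball [of "\<lambda>x. cayley_triple (\<phi> x)" g])
    show "continuous_on (cball 0 1) (\<lambda>x. cayley_triple (\<phi> x))"
      by (intro continuous_intros cont)
  qed (use g tri in auto)
  \<comment> \<open>The root \<open>\<sigma> * h\<close> is used so that on the sphere the
    eigenvalue equals \<open>g q\<close>, and \<open>t\<close> spans the same eigenline as the
    transported \<open>s\<close>.\<close>
  obtain t where t: "continuous_on (cball 0 1) t" "\<And>x. x \<in> cball 0 1 \<Longrightarrow> t x \<noteq> 0"
    "\<And>x. x \<in> cball 0 1 \<Longrightarrow> traceless_map (cayley_triple (\<eta> x)) (t x) = qmult (\<sigma> * h x, 0) (t x)"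
  proof (rule traceless_eigenvectors_on_ball [of "\<lambda>x. cayley_triple (\<eta> x)" "\<lambda>x. \<sigma> * h x"])
    show "continuous_on (cball 0 1) (\<lambda>x. cayley_triple (\<eta> x))"
      by (intro continuous_intros cont)
    show "continuous_on (cball 0 1) (\<lambda>x. \<sigma> * h x)"
      by (intro continuous_intros h)
  qed (use h tri \<sigma>1 in auto)
  \<comment> \<open>The coefficient of the orthogonal projection of \<open>v\<close> to the line of
    \<open>w\<close>; as an explicit formula it is visibly continuous, and for parallel vectors it
    gives \<open>v = c w\<close>.\<close>
  define c where "c q = (let v = qmult (s q) q; w = t (qcnj q)
    in (fst v * cnj (fst w) + snd v * cnj (snd w)) / complex_of_real ((norm w)\<^sup>2))" for q
  have cq: "qmult (s q) q = qmult (c q, 0) (t (qcnj q))" if q: "norm q = 1" for q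
  proof -
    let ?v = "qmult (s q) q" and ?w = "t (qcnj q)"
    have gq: "g q \<noteq> 0" and w: "?w \<noteq> 0" and gh: "\<sigma> * h (qcnj q) = g q"
      using q g(3)[of q] t(2)[of "qcnj q"] \<sigma>[of q] \<sigma>1 by (auto simp: field_simps)
    have "traceless_map (cayley_triple (\<eta> (qcnj q))) ?v = qmult (g q, 0) ?v"
      using s(3)[of q] q by (simp add: eq cayley_triple_rmat qmult_assoc)
    moreover have "traceless_map (cayley_triple (\<eta> (qcnj q))) ?w = qmult (g q, 0) ?w"
      using t(3)[of "qcnj q"] q gh by simp
    ultimately have par: "fst ?v * snd ?w = fst ?w * snd ?v"
      using traceless_eigenvector_unique gq by blast
    have nz: "fst ?w * cnj (fst ?w) + snd ?w * cnj (snd ?w) \<noteq> 0"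
      using w norm_quat[of ?w] by (metis norm_eq_zero of_real_eq_0_iff power_eq_0_iff)
    have "fst ?v * (fst ?w * cnj (fst ?w) + snd ?w * cnj (snd ?w))
        = (fst ?v * cnj (fst ?w) + snd ?v * cnj (snd ?w)) * fst ?w"
      "snd ?v * (fst ?w * cnj (fst ?w) + snd ?w * cnj (snd ?w))
        = (fst ?v * cnj (fst ?w) + snd ?v * cnj (snd ?w)) * snd ?w"
      using par by algebra+
    then have "fst ?v = c q * fst ?w" "snd ?v = c q * snd ?w"
      using nz unfolding c_def Let_def norm_quat by (auto simp: divide_simps)
    then show ?thesis
      by (intro prod_eqI) (simp_all add: qmult_def[of "(c q, 0)"])
  qed
  show False
  proof (rule hemispheres_not_compatible [of s t c])
    have "continuous_on (sphere 0 1) s"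
      by (rule continuous_on_subset [OF s(1)]) auto
    moreover have "continuous_on (sphere 0 1) (\<lambda>q. t (qcnj q))"
      by (rule continuous_on_compose2 [OF t(1)]) (auto intro!: continuous_intros)
    ultimately show "continuous_on (sphere 0 1) c"
      unfolding c_def Let_def using t(2)[of "qcnj _"]
      by (intro continuous_intros) auto
    show "c q \<noteq> 0" if "q \<in> sphere 0 1" for q
    proof
      assume "c q = 0"
      then have "qmult (s q) q = 0"
        using cq[of q] that by (simp add: qmult_eq_0_iff complex_pair_eq_0_iff)
      then show False
        using s(2)[of q] that by (auto simp: qmult_eq_0_iff)
    qed
  qed (use s t cq in auto)
qed

section \<open>Sections over quaternionic projective space\<close>

lemma topspace_quat_proj_space: "topspace quat_proj_space = qline ` (- {0})"
  by (simp add: quat_proj_space_def)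

lemma continuous_map_quat_proj_space_iff:
  "continuous_map quat_proj_space Y f \<longleftrightarrow> continuous_map (top_of_set (- {0})) Y (f \<circ> qline)"
  unfolding quat_proj_space_def
  using continuous_compose_quotient_map_eq [OF quotient_map_quotient_topology] by blast

lemma continuous_map_qline:
  assumes "continuous_on S f" "\<And>x. x \<in> S \<Longrightarrow> f x \<noteq> 0"
  shows "continuous_map (top_of_set S) quat_proj_space (\<lambda>x. qline (f x))"
proof -
  have "continuous_map (top_of_set S) (top_of_set (- {0})) f"
    using assms by auto
  moreover have "continuous_map (top_of_set (- {0})) quat_proj_space qline"
    unfolding quat_proj_space_def
    by (rule quotient_imp_continuous_map [OF quotient_map_quotient_topology])
  ultimately have "continuous_map (top_of_set S) quat_proj_space (qline \<circ> f)"
    by (rule continuous_map_compose)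
  then show ?thesis
    by (simp add: o_def)
qed

lemma continuous_section_iff:
  "continuous_section X E s \<longleftrightarrow> continuous_map X euclidean s \<and> (\<forall>x\<in>topspace X. s x \<in> E x)"
  by (auto simp: continuous_section_def total_space_def continuous_map_in_subtopology
      continuous_map_paired)

section \<open>Quaternionic lines and their coordinate blocks\<close>

lemma qscale_qscale: "qscale p (qscale q v) = qscale (qmult p q) v"
  by (simp add: qscale_def qmult_assoc vec_eq_iff)

lemma qscale_one [simp]: "qscale (1, 0) v = v"
  by (simp add: qscale_def vec_eq_iff)

lemma norm_qscale: "norm (qscale q v) = norm q * norm v"
  by (simp add: norm_vec_def qscale_def norm_qmult L2_set_right_distrib)

lemma qline_qscale:
  assumes "u \<noteq> 0"
  shows "qline (qscale u v) = qline v"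
proof -
  have "qscale q v = qscale (qmult q (qinv u)) (qscale u v)" for q
    by (simp add: qscale_qscale qmult_assoc qmult_qinv assms)
  then show ?thesis
    unfolding qline_def by (auto simp: qscale_qscale) 
qed

lemma self_in_qline: "v \<in> qline v"
  unfolding qline_def by (metis qscale_one rangeI)

lemma canonical_bundle_qline: "canonical_bundle (qline v) = range (\<lambda>q. complex_coords (qscale q v))"
  by (auto simp: canonical_bundle_def qline_def)

text \<open>The projection to quaternionic coordinate \<open>i\<close>, which trivializes the
  canonical bundle over lines with a representative having 1 there.\<close>

definition block :: "'n \<Rightarrow> complex ^ ('n::finite \<times> 2) ^ 2"
  where "block i = (\<chi> a p. if p = (i, a) then 1 else 0)"

lemma block_mult_nth: "(block i *v w) $ a = w $ (i, a)"
proof -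
  have "(block i *v w) $ a = (\<Sum>p\<in>UNIV. if p = (i, a) then w $ p else 0)"
    unfolding block_def matrix_vector_mult_def vec_lambda_beta by (intro sum.cong) auto
  then show ?thesis
    by simp
qed

lemma block_complex_coords: "block i *v complex_coords v = qvec (v $ i)"
  by (simp add: vec_eq_iff forall_2 block_mult_nth complex_coords_def)

lemma qvec_cases:
  obtains q where "x = qvec q"
proof
  show "x = qvec (x $ 1, x $ 2)"
    by (simp add: vec_eq_iff forall_2)
qed

lemma qvec_inject [simp]: "qvec p = qvec q \<longleftrightarrow> p = q"
  by (auto simp: vec_eq_iff forall_2 prod_eq_iff)

text \<open>The vector \<open>qscale q v\<close> has coordinates \<open>q\<close> at
  \<open>i\<close> and \<open>q\<close> times \<open>v $ j\<close> at \<open>j\<close>. Thus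
  \<open>rmat (v $ j)\<close> is the transition function between the two charts.\<close>

lemma block_canonical_bundle:
  assumes "v $ i = (1, 0)" "w \<in> canonical_bundle (qline v)"
  shows "block j *v w = rmat (v $ j) *v (block i *v w)"
proof -
  obtain q where "w = complex_coords (qscale q v)"
    using assms(2) by (auto simp: canonical_bundle_qline)
  then show ?thesis
    using assms(1) by (simp add: block_complex_coords rmat_qvec qscale_def)
qed

lemma inj_on_block:
  assumes "v $ i = (1, 0)"
  shows "inj_on ((*v) (block i)) (canonical_bundle (qline v))"
  by (auto simp: inj_on_def canonical_bundle_qline block_complex_coords qscale_def assms)

lemma ghz_type_tensor_map:
  assumes "ghz_type \<phi>" "invertible L" "invertible M" "invertible N"
  shows "ghz_type (tensor_map L M N \<phi>)"
  using assms unfolding ghz_type_def by (metis invertible_mult tensor_map_tensor_map)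

text \<open>Under \<open>block i\<close> the frames of the fiber become invertible 2 by 2 matrices;
  the transition rule for vectors passes to the frames and so to the tensor.\<close>

lemma ghz_type_block:
  assumes v: "v $ i = (1, 0)"
    and ghz: "ghz_type_in (canonical_bundle (qline v)) (canonical_bundle (qline v))
      (canonical_bundle (qline v)) \<psi>"
  shows "ghz_type (tensor_map (block i) (block i) (block i) \<psi>)"
    and "tensor_map (block j) (block j) (block j) \<psi> =
      tensor_map (rmat (v $ j)) (rmat (v $ j)) (rmat (v $ j))
        (tensor_map (block i) (block i) (block i) \<psi>)"
proof -
  let ?U = "canonical_bundle (qline v)"
  obtain F1 F2 F3 \<phi> where F: "bij_betw ((*v) F1) UNIV ?U" "bij_betw ((*v) F2) UNIV ?U"
    "bij_betw ((*v) F3) UNIV ?U" and \<phi>: "ghz_type \<phi>" "\<psi> = tensor_map F1 F2 F3 \<phi>"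
    using ghz unfolding ghz_type_in_def by blast
  have inv: "invertible (block i ** F)" if "bij_betw ((*v) F) UNIV ?U" for F :: "complex ^ 2 ^ _"
  proof -
    have "inj ((*v) (block i ** F))"
      using comp_inj_on [of "(*v) F" UNIV "(*v) (block i)"] that inj_on_block[of v i, OF v]
      by (simp add: bij_betw_def o_def matrix_vector_mul_assoc)
    then show ?thesis
      by (simp add: invertible_left_inverse matrix_left_invertible_injective)
  qed
  show "ghz_type (tensor_map (block i) (block i) (block i) \<psi>)"
    unfolding \<phi>(2) tensor_map_tensor_map by (intro ghz_type_tensor_map \<phi>(1) inv F)
  have "block j ** F = rmat (v $ j) ** (block i ** F)" if "bij_betw ((*v) F) UNIV ?U" for F :: "complex ^ 2 ^ _"
  proof -
    have "F *v x \<in> ?U" for x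
      using that by (auto simp: bij_betw_def)
    then show ?thesis
      by (simp add: matrix_eq block_canonical_bundle[OF v, of _ j] flip: matrix_vector_mul_assoc)
  qed
  then show "tensor_map (block j) (block j) (block j) \<psi> =
      tensor_map (rmat (v $ j)) (rmat (v $ j)) (rmat (v $ j))
        (tensor_map (block i) (block i) (block i) \<psi>)"
    unfolding \<phi>(2) tensor_map_tensor_map using F by metis
qed

section \<open>Charts of a projective line and the nonexistence results\<close>

lemma continuous_on_tensor_map:
  assumes "\<And>i j. continuous_on S (\<lambda>x. L x $ i $ j)" "\<And>i j. continuous_on S (\<lambda>x. M x $ i $ j)"
    "\<And>i j. continuous_on S (\<lambda>x. N x $ i $ j)" "continuous_on S \<psi>"
  shows "continuous_on S (\<lambda>x. tensor_map (L x) (M x) (N x) (\<psi> x))"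
  unfolding tensor_map_def
proof (intro continuous_on_vec_lambda)
  fix p
  show "continuous_on S (\<lambda>x. case p of (i, j, k) \<Rightarrow> \<Sum>i'\<in>UNIV. \<Sum>j'\<in>UNIV. \<Sum>k'\<in>UNIV.
      L x $ i $ i' * M x $ j $ j' * N x $ k $ k' * \<psi> x $ (i', j', k'))"
    by (cases p) (auto intro!: continuous_intros assms)
qed

text \<open>For \<open>i \<noteq> j\<close> these vectors represent a projective line
  \<open>HP^1\<close>; putting \<open>(1, 0)\<close> in place \<open>i\<close> or \<open>j\<close>
  gives its two charts, whose unit balls are the hemispheres.\<close>

definition two_coords :: "'n \<Rightarrow> 'n \<Rightarrow> quat \<Rightarrow> quat \<Rightarrow> quat ^ 'n"
  where "two_coords i j p q = (\<chi> k. if k = i then p else if k = j then q else 0)"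

lemma two_coords_nth: "two_coords i j p q $ i = p" "i \<noteq> j \<Longrightarrow> two_coords i j p q $ j = q"
  by (auto simp: two_coords_def)

lemma two_coords_nonzero:
  "two_coords i j (1, 0) q \<noteq> 0" "i \<noteq> j \<Longrightarrow> two_coords i j p (1, 0) \<noteq> 0"
  by (auto simp: vec_eq_iff two_coords_def zero_prod_def)

text \<open>Left multiplication by the unit \<open>q\<close> takes \<open>(qcnj q, 1)\<close> to
  \<open>(1, q)\<close>, whence the argument \<open>qcnj q\<close> in the gluing.\<close>

lemma qline_two_coords:
  assumes "norm q = 1"
  shows "qline (two_coords i j (qcnj q) (1, 0)) = qline (two_coords i j (1, 0) q)"
proof -
  have "two_coords i j (1, 0) q = qscale q (two_coords i j (qcnj q) (1, 0))"
    using assms by (auto simp: vec_eq_iff two_coords_def qscale_def qmult_qcnj)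
      (simp add: qmult_def zero_prod_def)
  moreover have "q \<noteq> 0"
    using assms by auto
  ultimately show ?thesis
    using qline_qscale by metis
qed

lemma continuous_on_two_coords [continuous_intros]:
  "continuous_on S f \<Longrightarrow> continuous_on S g \<Longrightarrow> continuous_on S (\<lambda>x. two_coords i j (f x) (g x))"
  unfolding two_coords_def
proof (intro continuous_on_vec_lambda)
  fix k
  assume "continuous_on S f" "continuous_on S g"
  then show "continuous_on S (\<lambda>x. if k = i then f x else if k = j then g x else 0)"
    by (cases "k = i"; cases "k = j") auto
qed

lemma continuous_on_charts:
  assumes "continuous_map quat_proj_space euclidean s" "i \<noteq> j"
  shows "continuous_on S (\<lambda>q. s (qline (two_coords i j (1, 0) q)))"
    and "continuous_on S (\<lambda>q. s (qline (two_coords i j q (1, 0))))"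
proof -
  have "continuous_map (top_of_set S) quat_proj_space (\<lambda>q. qline (two_coords i j (1, 0) q))"
    "continuous_map (top_of_set S) quat_proj_space (\<lambda>q. qline (two_coords i j q (1, 0)))"
    by (intro continuous_map_qline continuous_intros two_coords_nonzero assms(2))+
  from this[THEN continuous_map_compose, OF assms(1)]
  show "continuous_on S (\<lambda>q. s (qline (two_coords i j (1, 0) q)))"
    "continuous_on S (\<lambda>q. s (qline (two_coords i j q (1, 0))))"
    by (simp_all add: o_def)
qed

text \<open>On a projective line the two chart expressions of \<open>s\<close> satisfy the gluing
  equation of \<open>hemispheres_not_compatible\<close> with \<open>c = 1\<close>.\<close>

lemma canonical_bundle_no_section:
  fixes s :: "(quat ^ 'n) set \<Rightarrow> complex ^ ('n \<times> 2)"
  assumes "continuous_section quat_proj_space canonical_bundle s"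
    and "nowhere_vanishing quat_proj_space s" and ij: "(i::'n) \<noteq> j"
  shows False
proof -
  have s: "continuous_map quat_proj_space euclidean s"
      "\<And>v. v \<noteq> 0 \<Longrightarrow> s (qline v) \<in> canonical_bundle (qline v)"
      "\<And>v. v \<noteq> 0 \<Longrightarrow> s (qline v) \<noteq> 0"
    using assms by (auto simp: continuous_section_iff nowhere_vanishing_def topspace_quat_proj_space)
  define b where "b i w = (w $ (i, 1), w $ (i, 2))" for i :: 'n and w :: "complex ^ ('n \<times> 2)"
  have cont_b: "continuous_on S (\<lambda>x. b i (f x))" if "continuous_on S f" for S i and f :: "quat \<Rightarrow> _"
    unfolding b_def by (intro continuous_intros that)
  have qvec_b: "qvec (b k w) = block k *v w" for k w
    by (simp add: vec_eq_iff forall_2 block_mult_nth b_def)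
  have nz: "b k (s (qline v)) \<noteq> 0" if "v \<noteq> 0" "v $ k = (1, 0)" for k v
  proof
    assume "b k (s (qline v)) = 0"
    then have "block k *v s (qline v) = block k *v 0"
      by (simp flip: qvec_b) (simp add: vec_eq_iff forall_2)
    moreover have "(0 :: complex ^ ('n \<times> 2)) \<in> canonical_bundle (qline v)"
      by (auto simp: canonical_bundle_qline complex_coords_def qscale_def qmult_def vec_eq_iff
          intro!: image_eqI[where x = 0])
    ultimately have "s (qline v) = 0"
      using inj_on_block[of v k] s(2)[of v] that by (auto simp: inj_on_def)
    then show False
      using s(3) that by blast
  qed
  show False
  proof (rule hemispheres_not_compatible)
    show "continuous_on (cball 0 1) (\<lambda>q. b i (s (qline (two_coords i j (1, 0) q))))"
      "continuous_on (cball 0 1) (\<lambda>q. b j (s (qline (two_coords i j q (1, 0)))))"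
      by (intro cont_b continuous_on_charts s(1) ij)+
    show "b i (s (qline (two_coords i j (1, 0) q))) \<noteq> 0"
      "b j (s (qline (two_coords i j q (1, 0)))) \<noteq> 0" for q
      using ij by (intro nz two_coords_nonzero two_coords_nth)+
    show "continuous_on (sphere 0 1) (\<lambda>_::quat. 1::complex)"
      by simp
    fix q :: quat
    assume "q \<in> sphere 0 1"
    then have l: "qline (two_coords i j (qcnj q) (1, 0)) = qline (two_coords i j (1, 0) q)"
      by (simp add: qline_two_coords)
    let ?w = "s (qline (two_coords i j (1, 0) q))"
    have "qvec (b j ?w) = rmat q *v qvec (b i ?w)"
      using block_canonical_bundle[of "two_coords i j (1, 0) q" i ?w j] ij
      by (simp add: qvec_b two_coords_nth s(2) two_coords_nonzero)
    then show "qmult (b i ?w) q = qmult (1, 0) (b j (s (qline (two_coords i j (qcnj q) (1, 0)))))"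
      by (simp add: l rmat_qvec)
  qed simp
qed

lemma no_ghz_section:
  fixes \<Gamma> :: "(quat ^ 'n) set \<Rightarrow> complex ^ (('n \<times> 2) \<times> ('n \<times> 2) \<times> ('n \<times> 2))"
  assumes cont: "continuous_map quat_proj_space euclidean \<Gamma>"
    and ghz: "\<And>l. l \<in> topspace quat_proj_space \<Longrightarrow>
      ghz_type_in (canonical_bundle l) (canonical_bundle l) (canonical_bundle l) (\<Gamma> l)"
    and ij: "(i::'n) \<noteq> j"
  shows False
proof -
  have ghz': "ghz_type_in (canonical_bundle (qline v)) (canonical_bundle (qline v))
      (canonical_bundle (qline v)) (\<Gamma> (qline v))" if "v \<noteq> 0" for v
    using that by (intro ghz) (auto simp: topspace_quat_proj_space)
  let ?T = "\<lambda>k. tensor_map (block k) (block k) (block k)"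
  show False
  proof (rule no_ghz_on_hemispheres)
    show "continuous_on (cball 0 1) (\<lambda>q. ?T i (\<Gamma> (qline (two_coords i j (1, 0) q))))"
      "continuous_on (cball 0 1) (\<lambda>q. ?T j (\<Gamma> (qline (two_coords i j q (1, 0)))))"
      by (intro continuous_on_tensor_map continuous_on_charts cont ij continuous_on_const)+
    show "ghz_type (?T i (\<Gamma> (qline (two_coords i j (1, 0) q))))"
      "ghz_type (?T j (\<Gamma> (qline (two_coords i j q (1, 0)))))" for q
      using ij by (auto intro!: ghz_type_block(1) ghz' two_coords_nonzero simp: two_coords_nth)
    show "?T j (\<Gamma> (qline (two_coords i j (qcnj q) (1, 0)))) =
        tensor_map (rmat q) (rmat q) (rmat q) (?T i (\<Gamma> (qline (two_coords i j (1, 0) q))))"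
      if "norm q = 1" for q
      using ghz_type_block(2)[OF _ ghz', of "two_coords i j (1, 0) q" i j] ij that
      by (simp add: two_coords_nth qline_two_coords two_coords_nonzero)
  qed
qed

section \<open>A nowhere vanishing section of the tensor bundle\<close>

text \<open>The columns are the frame \<open>v\<close>, \<open>j v\<close> of the line through
  \<open>v\<close>.\<close>

definition line_param :: "quat ^ 'n \<Rightarrow> complex ^ 2 ^ ('n::finite \<times> 2)"
  where "line_param v = (\<chi> p. rmat (v $ fst p) $ snd p)"

lemma line_param_qvec: "line_param v *v qvec q = complex_coords (qscale q v)"
proof -
  have "(line_param v *v qvec q) $ (i, a) = complex_coords (qscale q v) $ (i, a)" for i a
  proof -
    have "(line_param v *v qvec q) $ (i, a) = (rmat (v $ i) *v qvec q) $ a"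
      by (simp add: line_param_def matrix_vector_mult_def)
    then show ?thesis
      using exhaust_2[of a] by (auto simp: rmat_qvec complex_coords_def qscale_def)
  qed
  then show ?thesis
    by (simp add: vec_eq_iff)
qed

lemma line_param_mem: "line_param v *v x \<in> canonical_bundle (qline v)"
  by (cases x rule: qvec_cases) (simp add: line_param_qvec canonical_bundle_qline)

text \<open>The change of frame under a new representative; an equivariant coefficient tensor
  cancels it.\<close>

lemma line_param_qscale: "line_param (qscale u v) = line_param v ** rmat u"
proof -
  have "line_param (qscale u v) *v x = (line_param v ** rmat u) *v x" for x
    by (cases x rule: qvec_cases)
      (simp add: line_param_qvec rmat_qvec qscale_qscale flip: matrix_vector_mul_assoc)
  then show ?thesis
    by (simp add: matrix_eq)
qed

lemma inj_line_param:
  assumes "v \<noteq> 0"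
  shows "inj ((*v) (line_param v))"
proof -
  obtain i where i: "v $ i \<noteq> 0"
    using assms by (auto simp: vec_eq_iff)
  then have "det (rmat (v $ i)) \<noteq> 0"
    by (simp add: det_rmat)
  then obtain R where "R ** rmat (v $ i) = mat 1"
    by (metis invertible_det_nz invertible_left_inverse)
  moreover have "block i ** line_param v = rmat (v $ i)"
  proof -
    have "(block i ** line_param v) *v x = rmat (v $ i) *v x" for x
      by (cases x rule: qvec_cases) (simp add: line_param_qvec rmat_qvec block_complex_coords
          qscale_def flip: matrix_vector_mul_assoc)
    then show ?thesis
      by (simp add: matrix_eq)
  qed
  ultimately have "(R ** block i) ** line_param v = mat 1"
    by (simp flip: matrix_mul_assoc)
  then show ?thesis
    by (auto simp: matrix_left_invertible_injective[symmetric])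
qed

lemma matrix_vector_mult_axis_nth: "(L *v axis j 1) $ i = L $ i $ j" for L :: "complex ^ 'b ^ 'a"
proof -
  have "(L *v axis j 1) $ i = (\<Sum>k\<in>UNIV. if k = j then L $ i $ k else 0)"
    unfolding matrix_vector_mult_def vec_lambda_beta by (intro sum.cong) (auto simp: axis_def)
  then show ?thesis
    by simp
qed

text \<open>Expanding \<open>\<psi>\<close> in the standard basis gives a combination of elementary
  tensors of columns.\<close>

lemma tensor_map_in_tensor_space:
  assumes "\<And>x. L *v x \<in> U" "\<And>x. M *v x \<in> V" "\<And>x. N *v x \<in> W"
  shows "tensor_map L M N \<psi> \<in> tensor_space U V W"
proof -
  have "tensor_map L M N \<psi> = (\<Sum>(i, j, k)\<in>UNIV. \<psi> $ (i, j, k) *s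
      tensor_vec (L *v axis i 1) (M *v axis j 1) (N *v axis k 1))"
    by (auto simp: vec_eq_iff tensor_map_component tensor_vec_def matrix_vector_mult_axis_nth
        split_def ac_simps intro!: sum.cong)
  also have "\<dots> \<in> tensor_space U V W"
    unfolding tensor_space_def split_def
    by (intro vec.span_sum vec.span_scale vec.span_base) (use assms in blast)
  finally show ?thesis .
qed

lemma tensor_map_linear:
  "tensor_map L M N (x + y) = tensor_map L M N x + tensor_map L M N y"
  "tensor_map L M N (x - y) = tensor_map L M N x - tensor_map L M N y"
  by (simp_all add: vec_eq_iff tensor_map_def sum.distrib sum_subtractf algebra_simps)

text \<open>Over unit vectors \<open>v\<close> a section of a tensor power of the canonical bundle is a map that is
  equivariant under right multiplication by unit quaternions, such as \<open>qcnj (v $ i)\<close>. The vector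
  \<open>e1 \<otimes> e2 - e2 \<otimes> e1\<close> is invariant and left multiplication by \<open>j = (0, 1)\<close> commutes with
  the action, so the following combination of four such maps is equivariant.\<close>

definition four_tensor :: "quat \<Rightarrow> quat \<Rightarrow> quat \<Rightarrow> quat \<Rightarrow> complex ^ (2 \<times> 2 \<times> 2)"
  where "four_tensor a b p r = (let e1 = axis 1 1; e2 = axis 2 1; jr = qvec (qmult (0, 1) r) in
    (tensor_vec e1 e2 (qvec a) - tensor_vec e2 e1 (qvec a))
    + (tensor_vec (qvec b) e1 e2 - tensor_vec (qvec b) e2 e1)
    + tensor_vec (qvec p) (qvec p) (qvec p)
    + (tensor_vec (qvec r) (qvec r) jr + tensor_vec (qvec r) jr (qvec r) + tensor_vec jr (qvec r) (qvec r)))"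

text \<open>The components of the transformed alternating tensor are 2 by 2 minors of
  \<open>R\<close>, hence multiples of \<open>det R\<close>.\<close>

lemma alternating_tensor_vec:
  fixes R :: "complex ^ 2 ^ 2"
  assumes "det R = 1"
  shows "tensor_vec (R *v axis 1 1) (R *v axis 2 1) x - tensor_vec (R *v axis 2 1) (R *v axis 1 1) x
      = tensor_vec (axis 1 1) (axis 2 1) x - tensor_vec (axis 2 1) (axis 1 1) x"
    and "tensor_vec x (R *v axis 1 1) (R *v axis 2 1) - tensor_vec x (R *v axis 2 1) (R *v axis 1 1)
      = tensor_vec x (axis 1 1) (axis 2 1) - tensor_vec x (axis 2 1) (axis 1 1)"
proof -
  have d: "R $ 1 $ 1 * R $ 2 $ 2 - R $ 1 $ 2 * R $ 2 $ 1 = 1"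
    using assms by (simp add: det_2)
  have *: "R $ i $ 1 * R $ j $ 2 - R $ i $ 2 * R $ j $ 1 =
      axis 1 1 $ i * axis 2 1 $ j - axis 2 1 $ i * axis 1 1 $ j" for i j
    using exhaust_2[of i] exhaust_2[of j] d by (auto simp: axis_def algebra_simps)
  show "tensor_vec (R *v axis 1 1) (R *v axis 2 1) x - tensor_vec (R *v axis 2 1) (R *v axis 1 1) x
      = tensor_vec (axis 1 1) (axis 2 1) x - tensor_vec (axis 2 1) (axis 1 1) x"
    "tensor_vec x (R *v axis 1 1) (R *v axis 2 1) - tensor_vec x (R *v axis 2 1) (R *v axis 1 1)
      = tensor_vec x (axis 1 1) (axis 2 1) - tensor_vec x (axis 2 1) (axis 1 1)"
    unfolding vec_eq_iff
    by (auto simp: tensor_vec_def matrix_vector_mult_axis_nth mult.assoc *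
        simp flip: left_diff_distrib right_diff_distrib)
      (simp_all only: mult.assoc[symmetric] left_diff_distrib[symmetric] *)
qed

lemma tensor_map_four_tensor:
  assumes "norm u = 1"
  shows "tensor_map (rmat u) (rmat u) (rmat u) (four_tensor a b p r) =
    four_tensor (qmult a u) (qmult b u) (qmult p u) (qmult r u)"
proof -
  have "det (rmat u) = 1"
    by (simp add: det_rmat assms)
  then show ?thesis
    by (simp add: four_tensor_def Let_def tensor_map_linear tensor_map_tensor_vec rmat_qvec qmult_assoc
        alternating_tensor_vec)
qed

text \<open>The contractions of the first two and of the last two factors by the determinant kill the
  symmetric part and give \<open>2 a - b\<close> and \<open>2 b - a\<close>. The symmetric part is the binary cubic
  \<open>p\<^sup>3 + 3 r\<^sup>2 (j r)\<close>, and as \<open>r\<close> and \<open>j r\<close> are linearly independent for nonzero \<open>r\<close>, no cube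
  cancels \<open>r\<^sup>2 (j r)\<close>.\<close>

lemma four_tensor_eq_0D:
  assumes "four_tensor a b p r = 0"
  shows "a = 0 \<and> b = 0 \<and> p = 0 \<and> r = 0"
proof -
  obtain a1 a2 b1 b2 x y z w where abpr: "a = (a1, a2)" "b = (b1, b2)" "p = (x, y)" "r = (z, w)"
    by (metis surj_pair)
  let ?z = "cnj z" and ?w = "cnj w"
  have c: "four_tensor a b p r $ (i, j, k) = 0" for i j k
    using assms by simp
  have e: "x^3 - 3 * z^2 * ?w = 0"
    "b1 + x^2 * y + z^2 * ?z - 2 * z * w * ?w = 0"
    "a1 - b1 + x^2 * y + z^2 * ?z - 2 * z * w * ?w = 0"
    "- a1 + x^2 * y + z^2 * ?z - 2 * z * w * ?w = 0"
    "a2 + x * y^2 + 2 * z * w * ?z - w^2 * ?w = 0"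
    "b2 - a2 + x * y^2 + 2 * z * w * ?z - w^2 * ?w = 0"
    "- b2 + x * y^2 + 2 * z * w * ?z - w^2 * ?w = 0"
    "y^3 + 3 * w^2 * ?z = 0"
    using c[of 1 1 1] c[of 1 1 2] c[of 1 2 1] c[of 2 1 1] c[of 1 2 2] c[of 2 1 2] c[of 2 2 1] c[of 2 2 2]
    by (simp_all add: four_tensor_def Let_def tensor_vec_def axis_def abpr qmult_def power2_eq_square
        power3_eq_cube algebra_simps)
  \<comment> \<open>The components with exactly one index 2 share their symmetric part, so
    \<open>b1\<close>, \<open>a1 - b1\<close> and \<open>- a1\<close> coincide and vanish; likewise
    for two indices 2.\<close>
  have ab: "a1 = 0" "b1 = 0" "a2 = 0" "b2 = 0"
    using e(2-7) by algebra+
  \<comment> \<open>The cubic is evaluated on the covectors \<open>(- w, z)\<close> and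
    \<open>(?z, ?w)\<close>, which kill \<open>r\<close> and \<open>j r\<close>; only the cube of
    \<open>p\<close> survives. Their determinant is minus the squared norm of \<open>r\<close>, so
    \<open>p = 0\<close> unless \<open>r = 0\<close>.\<close>
  have "(z * y - w * x)^3 = 0" "(x * ?z + y * ?w)^3 = 0"
    using e ab by algebra+
  then have xy: "z * y = w * x" "x * ?z + y * ?w = 0"
    by simp_all
  then have "x * (z * ?z + w * ?w) = 0" "y * (z * ?z + w * ?w) = 0"
    by algebra+
  moreover have "z * ?z + w * ?w = complex_of_real ((norm r)\<^sup>2)"
    by (simp only: norm_quat abpr fst_conv snd_conv)
  ultimately have "r = 0 \<or> x = 0 \<and> y = 0"
    by auto
  then have "p = 0 \<and> r = 0"
  proof
    assume "r = 0"
    then show ?thesis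
      using e(1,8) by (simp add: abpr zero_prod_def)
  next
    assume "x = 0 \<and> y = 0"
    then have "z = 0 \<or> w = 0" "z^2 * ?z = 2 * z * w * ?w" "2 * z * w * ?z = w^2 * ?w"
      using e ab by auto
    then show ?thesis
      using \<open>x = 0 \<and> y = 0\<close> by (auto simp: abpr zero_prod_def)
  qed
  then show ?thesis
    by (simp add: ab abpr zero_prod_def)
qed

section \<open>Continuity and construction of the section\<close>

lemma continuous_on_rmat_nth [continuous_intros]:
  assumes "continuous_on S f"
  shows "continuous_on S (\<lambda>x. rmat (f x) $ i $ j)"
  using exhaust_2[of i] exhaust_2[of j]
  by (elim disjE; simp only: rmat_nth; intro continuous_intros assms)

lemma continuous_on_qvec [continuous_intros]:
  assumes "continuous_on S f"
  shows "continuous_on S (\<lambda>x. qvec (f x))"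
  unfolding qvec_def
proof (rule continuous_on_vec_lambda)
  show "continuous_on S (\<lambda>x. if i = 1 then fst (f x) else snd (f x))" for i :: 2
    by (cases "i = 1") (auto intro!: continuous_intros assms)
qed

lemma continuous_on_tensor_vec [continuous_intros]:
  assumes "continuous_on S f" "continuous_on S g" "continuous_on S h"
  shows "continuous_on S (\<lambda>x. tensor_vec (f x) (g x) (h x))"
  unfolding tensor_vec_def
proof (intro continuous_on_vec_lambda)
  fix p
  show "continuous_on S (\<lambda>x. case p of (i, j, k) \<Rightarrow> f x $ i * g x $ j * h x $ k)"
    by (cases p) (auto intro!: continuous_intros assms)
qed

text \<open>\<open>four_tensor\<close> detects four coordinates at once; repeated indices are
  allowed, so smaller dimensions are covered too.\<close>

lemma tensor_bundle_section:
  fixes i j k l :: "'n::finite"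
  assumes cover: "UNIV = {i, j, k, l}"
  shows "\<exists>\<Gamma>. continuous_section quat_proj_space (tensor_bundle canonical_bundle canonical_bundle canonical_bundle) \<Gamma>
    \<and> nowhere_vanishing quat_proj_space (\<Gamma> :: (quat ^ 'n) set \<Rightarrow> _)"
proof -
  define G where "G v = tensor_map (line_param v) (line_param v) (line_param v)
    (four_tensor (qcnj (v $ i)) (qcnj (v $ j)) (qcnj (v $ k)) (qcnj (v $ l)))" for v :: "quat ^ 'n"
  have G_qscale: "G (qscale u v) = G v" if "norm u = 1" for u v
  \<comment> \<open>The frame contributes \<open>rmat u\<close> and each argument a factor
    \<open>qcnj u\<close>; these cancel, so on unit vectors \<open>G\<close> depends only on the
    line.\<close>
  proof -
    have u: "qmult (qcnj u) u = (1, 0)"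
      by (simp add: qmult_qcnj that)
    show ?thesis
      unfolding G_def line_param_qscale tensor_map_tensor_map[symmetric] tensor_map_four_tensor[OF that]
      by (simp add: qscale_def qcnj_qmult qmult_assoc u)
  qed
  have G_nz: "G v \<noteq> 0" if "v \<noteq> 0" for v
  proof
    assume "G v = 0"
    then have "four_tensor (qcnj (v $ i)) (qcnj (v $ j)) (qcnj (v $ k)) (qcnj (v $ l)) = 0"
      unfolding G_def using inj_line_param[OF that] tensor_map_eq_0D by blast
    then have "v $ i = 0" "v $ j = 0" "v $ k = 0" "v $ l = 0"
      by (auto dest!: four_tensor_eq_0D simp: qcnj_def prod_eq_iff)
    then have "v $ m = 0" for m
      using cover by (metis UNIV_I empty_iff insert_iff)
    then show False
      using that by (simp add: vec_eq_iff)
  qed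
  have G_mem: "G v \<in> tensor_bundle canonical_bundle canonical_bundle canonical_bundle (qline v)" for v
    unfolding G_def tensor_bundle_def by (intro tensor_map_in_tensor_space line_param_mem)
  \<comment> \<open>Unit representatives of a line differ by a unit quaternion, so the choice does
    not matter.\<close>
  define \<Gamma> where "\<Gamma> m = G (SOME v. norm v = 1 \<and> qline v = m)" for m
  have \<Gamma>: "\<Gamma> (qline v) = G v" if "norm v = 1" for v
  proof -
    define w where "w = (SOME w. norm w = 1 \<and> qline w = qline v)"
    have w: "norm w = 1 \<and> qline w = qline v"
      unfolding w_def by (rule someI[of _ v]) (simp add: that)
    then obtain u where u: "w = qscale u v"
      using self_in_qline[of w] unfolding qline_def by auto
    moreover have "norm u = 1"
      using w that u by (simp add: norm_qscale)
    ultimately show ?thesis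
      by (simp add: \<Gamma>_def G_qscale flip: w_def)
  qed
  have normalize: "norm (v /\<^sub>R norm v) = 1 \<and> qline (v /\<^sub>R norm v) = qline v" if "v \<noteq> 0" for v :: "quat ^ 'n"
  proof -
    have "v /\<^sub>R norm v = qscale (complex_of_real (1 / norm v), 0) v"
      by (simp add: vec_eq_iff qscale_def qmult_def scaleR_conv_of_real prod_eq_iff divide_simps)
    moreover have "(complex_of_real (1 / norm v), 0) \<noteq> (0 :: quat)"
      using that by (simp add: complex_pair_eq_0_iff)
    ultimately show ?thesis
      using that by (metis norm_sgn qline_qscale sgn_div_norm)
  qed
  have \<Gamma>_qline: "\<Gamma> (qline v) = G (v /\<^sub>R norm v)" if "v \<noteq> 0" for v
    using \<Gamma> normalize[OF that] by metis
  \<comment> \<open>Continuity on the quotient is tested on nonzero vectors, where normalization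
    supplies a continuous unit representative.\<close>
  have "continuous_on (- {0}) (\<lambda>v. G (v /\<^sub>R norm v))"
    unfolding G_def four_tensor_def Let_def line_param_def
    by (intro continuous_on_tensor_map) (auto intro!: continuous_intros)
  then have "continuous_on (- {0}) (\<Gamma> \<circ> qline)"
    by (rule continuous_on_eq) (simp add: \<Gamma>_qline)
  then have "continuous_map quat_proj_space euclidean \<Gamma>"
    by (simp add: continuous_map_quat_proj_space_iff)
  moreover have "\<Gamma> m \<in> tensor_bundle canonical_bundle canonical_bundle canonical_bundle m \<and> \<Gamma> m \<noteq> 0"
    if "m \<in> topspace quat_proj_space" for m
  proof -
    obtain w where "w \<noteq> 0" "m = qline w"
      using \<open>m \<in> topspace quat_proj_space\<close> by (auto simp: topspace_quat_proj_space)
    then obtain v where v: "norm v = 1" "m = qline v"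
      using normalize[of w] by metis
    then have "v \<noteq> 0"
      by auto
    then show ?thesis
      unfolding v(2) \<Gamma>[OF v(1)] using G_nz G_mem by blast
  qed
  ultimately show ?thesis
    by (auto simp: continuous_section_iff nowhere_vanishing_def)
qed

section \<open>Assembly of the three claims for \<open>k \<le> 3\<close>\<close>

theorem mainTheorem3:
  fixes k :: nat
    and HP :: "(quat ^ 'n) set topology"
    and A B C :: "(quat ^ 'n) set \<Rightarrow> (complex ^ ('n \<times> 2)) set"
    and P :: "(quat ^ 'n) set \<Rightarrow> (complex ^ (('n \<times> 2) \<times> ('n \<times> 2) \<times> ('n \<times> 2))) set"
  assumes "k \<in> {1, 2, 3}" and "CARD('n) = k + 1"
    and "HP = quat_proj_space"
    and "A = canonical_bundle" and "B = canonical_bundle" and "C = canonical_bundle"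
    and "P = tensor_bundle A B C"
  shows "(\<forall>E \<in> {A, B, C}. \<not> (\<exists>s. continuous_section HP E s \<and> nowhere_vanishing HP s))
    \<and> (\<exists>\<Gamma>. continuous_section HP P \<Gamma> \<and> nowhere_vanishing HP \<Gamma>)
    \<and> \<not> (\<exists>\<Gamma>. continuous_section HP P \<Gamma> \<and> nowhere_vanishing HP \<Gamma> \<and>
            (\<forall>x \<in> topspace HP. ghz_type_in (A x) (B x) (C x) (\<Gamma> x)))"
proof -
  have card: "2 \<le> CARD('n)" "CARD('n) \<le> 4"
    using assms(1,2) by auto
  obtain i j :: 'n where ij: "i \<noteq> j"
    using card(1) by (metis card_2_iff' ex_card)
  obtain xs :: "'n list" where xs: "set xs = UNIV" "length xs = CARD('n)"
    by (metis finite_distinct_list finite distinct_card)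
  \<comment> \<open>There are \<open>k + 1 \<le> 4\<close> coordinates; repeating the first one
    fills the list up to four.\<close>
  obtain a b c d :: 'n where cover: "UNIV = {a, b, c, d}"
  proof -
    consider "length xs = 2" | "length xs = 3" | "length xs = 4"
      using card xs(2) by linarith
    then show thesis
    proof cases
      case 1
      then obtain a b where "xs = [a, b]"
        by (auto simp: numeral_eq_Suc length_Suc_conv)
      then show ?thesis
        using that[of a a a b] xs(1) by simp
    next
      case 2
      then obtain a b c where "xs = [a, b, c]"
        by (auto simp: numeral_eq_Suc length_Suc_conv)
      then show ?thesis
        using that[of a a b c] xs(1) by simp
    next
      case 3
      then obtain a b c d where "xs = [a, b, c, d]"
        by (auto simp: numeral_eq_Suc length_Suc_conv)
      then show ?thesis
        using that[of a b c d] xs(1) by simp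
    qed
  qed
  have "\<not> (\<exists>s. continuous_section HP E s \<and> nowhere_vanishing HP s)" if "E \<in> {A, B, C}" for E
    using that canonical_bundle_no_section [OF _ _ ij] unfolding assms(3-6) by blast
  moreover have "\<exists>\<Gamma>. continuous_section HP P \<Gamma> \<and> nowhere_vanishing HP \<Gamma>"
    unfolding assms(3-7) by (rule tensor_bundle_section [OF cover])
  moreover have "\<not> (\<exists>\<Gamma>. continuous_section HP P \<Gamma> \<and> nowhere_vanishing HP \<Gamma> \<and>
      (\<forall>x \<in> topspace HP. ghz_type_in (A x) (B x) (C x) (\<Gamma> x)))"
    using no_ghz_section [OF _ _ ij] unfolding assms(3-6) continuous_section_iff by blast
  ultimately show ?thesis
    by blast
qed

end
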